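(* Let $m$ be a positive integer. The smallest constant $B$ such that $$\left(\sum_{j_1,\ldots,j_m=1}^{\infty}|T(e_{j_1},\ldots,e_{j_m})|^{\frac{2m}{m+1}}\right)^{\frac{m+1}{2m}}\le B\,\|T\|$$ holds for all continuous $m$-linear forms $T\colon c_0\times\cdots\times c_0\to\mathbb{R}$ composed of at most $4^{m-1}$ monomials is precisely $2^{1-\frac1m}$.
   Context: $c_0$ is the real Banach space of real null sequences with the sup norm, $(e_j)$ its canonical basis, and $\|T\|$ is the usual sup norm over the product of closed unit balls. The number of monomials of $T(x^{(1)},\ldots,x^{(m)})=\sum\alpha_{i_1,\ldots,i_m}x^{(1)}_{i_1}\cdots x^{(m)}_{i_m}$ is $\operatorname{card}\{(i_1,\ldots,i_m):\alpha_{i_1,\ldots,i_m}\neq0\}$. *)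

theory Defs
  imports "HOL-Analysis.Analysis"
begin

section \<open>The Banach space of real null sequences\<close>

typedef c0 = "{x :: nat \<Rightarrow> real. x \<longlonglongrightarrow> 0}"
  morphisms c0_coord Abs_c0
  by (rule exI[of _ "\<lambda>_. 0"]) simp

setup_lifting type_definition_c0

lemma c0_coord_tendsto: "c0_coord x \<longlonglongrightarrow> 0"
  using c0_coord[of x] by simp

lemma c0_eqI: "(\<And>n. c0_coord x n = c0_coord y n) \<Longrightarrow> x = y"
  by (simp add: c0_coord_inject[symmetric] fun_eq_iff)

instantiation c0 :: real_vector
begin

lift_definition zero_c0 :: c0 is "\<lambda>_. 0" by simp

lift_definition plus_c0 :: "c0 \<Rightarrow> c0 \<Rightarrow> c0" is "\<lambda>x y n. x n + y n"
  using tendsto_add by fastforce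

lift_definition uminus_c0 :: "c0 \<Rightarrow> c0" is "\<lambda>x n. - x n"
  using tendsto_minus by fastforce

lift_definition minus_c0 :: "c0 \<Rightarrow> c0 \<Rightarrow> c0" is "\<lambda>x y n. x n - y n"
  using tendsto_diff by fastforce

lift_definition scaleR_c0 :: "real \<Rightarrow> c0 \<Rightarrow> c0" is "\<lambda>r x n. r * x n"
  by (simp add: tendsto_mult_right_zero)

instance
  by standard (transfer; simp add: fun_eq_iff algebra_simps)+

end

lemmas c0_coord_simps [simp] =
  zero_c0.rep_eq plus_c0.rep_eq uminus_c0.rep_eq minus_c0.rep_eq scaleR_c0.rep_eq

lemma bdd_above_c0_coord: "bdd_above (range (\<lambda>n. \<bar>c0_coord x n\<bar>))"
proof -
  have "Bseq (c0_coord x)"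
    using c0_coord_tendsto by (intro convergent_imp_Bseq convergentI)
  then obtain K where "\<And>n. norm (c0_coord x n) \<le> K"
    unfolding Bseq_def by blast
  then show ?thesis
    by (intro bdd_aboveI[where M = K]) auto
qed

instantiation c0 :: real_normed_vector
begin

definition norm_c0 :: "c0 \<Rightarrow> real" where
  "norm x = (SUP n. \<bar>c0_coord x n\<bar>)"

definition dist_c0 :: "c0 \<Rightarrow> c0 \<Rightarrow> real" where
  "dist x (y :: c0) = norm (x - y)"

definition sgn_c0 :: "c0 \<Rightarrow> c0" where
  "sgn (x :: c0) = x /\<^sub>R norm x"

definition uniformity_c0 :: "(c0 \<times> c0) filter" where
  "uniformity = (INF e\<in>{0<..}. principal {(x, y :: c0). dist x y < e})"

definition open_c0 :: "c0 set \<Rightarrow> bool" where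
  "open (U :: c0 set) \<longleftrightarrow> (\<forall>x\<in>U. \<forall>\<^sub>F (x', y) in uniformity. x' = x \<longrightarrow> y \<in> U)"

instance
proof
  have coord_le: "\<bar>c0_coord x n\<bar> \<le> norm x" for x n
    unfolding norm_c0_def by (intro cSUP_upper bdd_above_c0_coord UNIV_I)
  have norm_le: "norm x \<le> K" if "\<And>n. \<bar>c0_coord x n\<bar> \<le> K" for x :: c0 and K
    unfolding norm_c0_def using that by (intro cSUP_least) auto
  fix x y :: c0 and a :: real
  show "(norm x = 0) = (x = 0)"
  proof
    assume "norm x = 0"
    then show "x = 0" using coord_le[of x] by (intro c0_eqI) simp
  next
    assume "x = 0"
    then show "norm x = 0" by (simp add: norm_c0_def)
  qed
  show "norm (x + y) \<le> norm x + norm y"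
  proof (rule norm_le)
    fix n
    show "\<bar>c0_coord (x + y) n\<bar> \<le> norm x + norm y"
      using coord_le[of x n] coord_le[of y n] by simp
  qed
  have scale_le: "norm (r *\<^sub>R z) \<le> \<bar>r\<bar> * norm z" for r and z :: c0
    by (intro norm_le) (auto simp: abs_mult intro!: mult_left_mono coord_le)
  show "norm (a *\<^sub>R x) = \<bar>a\<bar> * norm x"
  proof (cases "a = 0")
    case True
    then show ?thesis by (simp add: norm_c0_def)
  next
    case False
    then have "norm x \<le> \<bar>inverse a\<bar> * norm (a *\<^sub>R x)"
      using scale_le[of "inverse a" "a *\<^sub>R x"] by simp
    then have "\<bar>a\<bar> * norm x \<le> norm (a *\<^sub>R x)"
      using False by (simp add: field_simps abs_inverse)
    then show ?thesis using scale_le[of a x] by linarith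
  qed
qed (rule dist_c0_def sgn_c0_def uniformity_c0_def open_c0_def)+

end

lemma abs_c0_coord_le_norm: "\<bar>c0_coord x n\<bar> \<le> norm x"
  unfolding norm_c0_def by (intro cSUP_upper bdd_above_c0_coord UNIV_I)

lemma norm_c0_le: "(\<And>n. \<bar>c0_coord x n\<bar> \<le> K) \<Longrightarrow> norm x \<le> K"
  unfolding norm_c0_def by (intro cSUP_least) auto

instance c0 :: banach
proof
  fix X :: "nat \<Rightarrow> c0"
  assume "Cauchy X"
  have close: "\<bar>c0_coord (X i) n - c0_coord (X j) n\<bar> \<le> dist (X i) (X j)" for i j n
    using abs_c0_coord_le_norm[of "X i - X j" n] by (simp add: dist_norm)
  define L where "L = (\<lambda>n. lim (\<lambda>k. c0_coord (X k) n))"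
  have "Cauchy (\<lambda>k. c0_coord (X k) n)" for n
    using \<open>Cauchy X\<close> close unfolding Cauchy_def dist_real_def by (meson le_less_trans)
  then have L: "(\<lambda>k. c0_coord (X k) n) \<longlonglongrightarrow> L n" for n
    unfolding L_def by (simp add: Cauchy_convergent_iff convergent_LIMSEQ_iff)
  have unif: "\<exists>M. \<forall>k\<ge>M. \<forall>n. \<bar>c0_coord (X k) n - L n\<bar> \<le> e" if "e > 0" for e
  proof -
    obtain M where M: "\<And>i j. i \<ge> M \<Longrightarrow> j \<ge> M \<Longrightarrow> dist (X i) (X j) < e"
      using \<open>Cauchy X\<close> \<open>e > 0\<close> unfolding Cauchy_def by blast
    have "\<bar>c0_coord (X k) n - L n\<bar> \<le> e" if "k \<ge> M" for k n
    proof (rule LIMSEQ_le_const2)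
      show "(\<lambda>j. \<bar>c0_coord (X k) n - c0_coord (X j) n\<bar>) \<longlonglongrightarrow> \<bar>c0_coord (X k) n - L n\<bar>"
        by (intro tendsto_intros L)
      show "\<exists>N. \<forall>j\<ge>N. \<bar>c0_coord (X k) n - c0_coord (X j) n\<bar> \<le> e"
        using M[OF that] close[of k n] by (meson less_imp_le order_trans)
    qed
    then show ?thesis by blast
  qed
  have "L \<longlonglongrightarrow> 0"
  proof (rule LIMSEQ_I)
    fix r :: real
    assume "r > 0"
    then obtain k where k: "\<And>n. \<bar>c0_coord (X k) n - L n\<bar> \<le> r / 2"
      using unif[of "r / 2"] by auto
    obtain N where N: "\<And>n. n \<ge> N \<Longrightarrow> \<bar>c0_coord (X k) n\<bar> < r / 2"
      using LIMSEQ_D[OF c0_coord_tendsto[of "X k"], of "r / 2"] \<open>r > 0\<close> by auto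
    have "norm (L n - 0) < r" if "n \<ge> N" for n
      using k[of n] N[OF that] by (simp add: abs_if split: if_splits)
    then show "\<exists>N. \<forall>n\<ge>N. norm (L n - 0) < r" by blast
  qed
  then have coord: "c0_coord (Abs_c0 L) = L"
    by (simp add: Abs_c0_inverse)
  have "X \<longlonglongrightarrow> Abs_c0 L"
  proof (rule metric_LIMSEQ_I)
    fix r :: real
    assume "r > 0"
    then obtain M where M: "\<And>k n. k \<ge> M \<Longrightarrow> \<bar>c0_coord (X k) n - L n\<bar> \<le> r / 2"
      using unif[of "r / 2"] by auto
    have "dist (X k) (Abs_c0 L) < r" if "k \<ge> M" for k
    proof -
      have "dist (X k) (Abs_c0 L) \<le> r / 2"
        unfolding dist_norm using M[OF that] by (intro norm_c0_le) (simp add: coord)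
      then show ?thesis using \<open>r > 0\<close> by simp
    qed
    then show "\<exists>M. \<forall>k\<ge>M. dist (X k) (Abs_c0 L) < r" by blast
  qed
  then show "convergent X" by (rule convergentI)
qed

lift_definition c0_basis :: "nat \<Rightarrow> c0" is "\<lambda>j n. if n = j then 1 else 0"
proof -
  fix j :: nat
  show "(\<lambda>n. if n = j then 1 else 0 :: real) \<longlonglongrightarrow> 0"
    by (intro tendsto_eventually eventually_sequentiallyI[of "Suc j"]) auto
qed


section \<open>Multilinear forms on powers of a normed space\<close>

text \<open>
  An element of the \<open>m\<close>-fold product \<open>E \<times> \<dots> \<times> E\<close> is a function in \<open>{..<m} \<rightarrow>\<^sub>E UNIV\<close>; a form
  on the product is only ever evaluated there. Factors and coordinates are numbered from \<open>0\<close>.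
\<close>

definition multilinear_form :: "nat \<Rightarrow> ((nat \<Rightarrow> 'a :: real_vector) \<Rightarrow> real) \<Rightarrow> bool" where
  "multilinear_form m T \<longleftrightarrow>
     (\<forall>x \<in> {..<m} \<rightarrow>\<^sub>E UNIV. \<forall>k<m. linear (\<lambda>u. T (x(k := u))))"

definition continuous_multilinear_form ::
    "nat \<Rightarrow> ((nat \<Rightarrow> 'a :: real_normed_vector) \<Rightarrow> real) \<Rightarrow> bool" where
  "continuous_multilinear_form m T \<longleftrightarrow>
     multilinear_form m T \<and>
     continuous_map (product_topology (\<lambda>_. euclidean) {..<m}) euclideanreal T"

definition form_norm :: "nat \<Rightarrow> ((nat \<Rightarrow> 'a :: real_normed_vector) \<Rightarrow> real) \<Rightarrow> real" where
  "form_norm m T = (SUP x \<in> {..<m} \<rightarrow>\<^sub>E cball 0 1. \<bar>T x\<bar>)"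


section \<open>Monomials of forms on the space of null sequences\<close>

text \<open>
  \<open>T(x) = \<Sum> \<alpha>\<^sub>j x\<^sub>0(j\<^sub>0) \<cdots> x\<^sub>m\<^sub>-\<^sub>1(j\<^sub>m\<^sub>-\<^sub>1)\<close> over all multi-indices \<open>j\<close>. The series need not
  converge unconditionally for a general continuous form, so it is read as the limit of its
  cubical partial sums.
\<close>

definition monomial_expansion ::
    "nat \<Rightarrow> ((nat \<Rightarrow> c0) \<Rightarrow> real) \<Rightarrow> ((nat \<Rightarrow> nat) \<Rightarrow> real) \<Rightarrow> bool" where
  "monomial_expansion m T \<alpha> \<longleftrightarrow>
     (\<forall>x \<in> {..<m} \<rightarrow>\<^sub>E UNIV.
        (\<lambda>N. \<Sum>j \<in> {..<m} \<rightarrow>\<^sub>E {..<N}. \<alpha> j * (\<Prod>k<m. c0_coord (x k) (j k))) \<longlonglongrightarrow> T x)"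

definition at_most_monomials :: "nat \<Rightarrow> ((nat \<Rightarrow> c0) \<Rightarrow> real) \<Rightarrow> nat \<Rightarrow> bool" where
  "at_most_monomials m T N \<longleftrightarrow>
     (\<exists>\<alpha>. monomial_expansion m T \<alpha> \<and>
          finite {j \<in> {..<m} \<rightarrow>\<^sub>E UNIV. \<alpha> j \<noteq> 0} \<and>
          card {j \<in> {..<m} \<rightarrow>\<^sub>E UNIV. \<alpha> j \<noteq> 0} \<le> N)"

text \<open>The coefficients are determined by \<open>T\<close>, so the number of monomials is well defined.\<close>

lemma monomial_expansion_coefficient:
  assumes "monomial_expansion m T \<alpha>" and j: "j \<in> {..<m} \<rightarrow>\<^sub>E UNIV"
  shows "T (\<lambda>k\<in>{..<m}. c0_basis (j k)) = \<alpha> j"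
proof -
  let ?x = "\<lambda>k\<in>{..<m}. c0_basis (j k)"
  let ?S = "\<lambda>N. \<Sum>i \<in> {..<m} \<rightarrow>\<^sub>E {..<N}. \<alpha> i * (\<Prod>k<m. c0_coord (?x k) (i k))"
  have prod: "(\<Prod>k<m. c0_coord (?x k) (i k)) = (if i = j then 1 else 0)"
    if i: "i \<in> {..<m} \<rightarrow>\<^sub>E UNIV" for i
  proof (cases "i = j")
    case True
    then show ?thesis by (simp add: c0_basis.rep_eq)
  next
    case False
    then obtain k where "k < m" "i k \<noteq> j k"
      using PiE_ext[OF i j] by auto
    then have "\<exists>k\<in>{..<m}. c0_coord (?x k) (i k) = 0"
      by (intro bexI[of _ k]) (simp_all add: c0_basis.rep_eq)
    then show ?thesis
      using False prod_zero[OF finite_lessThan] by simp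
  qed
  obtain M where "\<forall>n \<in> j ` {..<m}. n < M"
    using finite_nat_set_iff_bounded[of "j ` {..<m}"] by blast
  then have M: "\<And>k. k < m \<Longrightarrow> j k < M" by simp
  have "?S N = \<alpha> j" if "N \<ge> M" for N
  proof -
    have "?S N = (\<Sum>i \<in> {..<m} \<rightarrow>\<^sub>E {..<N}. if i = j then \<alpha> i else 0)"
    proof (rule sum.cong[OF refl])
      fix i assume "i \<in> {..<m} \<rightarrow>\<^sub>E {..<N}"
      then have "i \<in> {..<m} \<rightarrow>\<^sub>E UNIV" by (auto simp: PiE_iff)
      from prod[OF this]
      show "\<alpha> i * (\<Prod>k<m. c0_coord (?x k) (i k)) = (if i = j then \<alpha> i else 0)" by simp
    qed
    also have "\<dots> = (if j \<in> {..<m} \<rightarrow>\<^sub>E {..<N} then \<alpha> j else 0)"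
      by (intro sum.delta finite_PiE) auto
    also have "\<dots> = \<alpha> j"
      using j order.strict_trans2[OF M that] by (simp add: PiE_iff)
    finally show ?thesis .
  qed
  then have "?S \<longlonglongrightarrow> \<alpha> j"
    by (intro tendsto_eventually eventually_sequentiallyI)
  moreover have "?S \<longlonglongrightarrow> T ?x"
    by (rule assms(1)[unfolded monomial_expansion_def, rule_format]) (simp add: PiE_iff extensional_def)
  ultimately show ?thesis by (rule LIMSEQ_unique[symmetric])
qed


section \<open>The constants in the inequality\<close>

text \<open>
  For forms with finitely many monomials the sum has finite support; the unconditional sum
  \<^const>\<open>infsum\<close> is thus never used at a non-summable family.
\<close>

definition admissible_constants :: "nat \<Rightarrow> nat \<Rightarrow> real set" where
  "admissible_constants m N =
     {B. \<forall>T. continuous_multilinear_form m T \<longrightarrow> at_most_monomials m T N \<longrightarrow>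
        (\<Sum>\<^sub>\<infinity>j \<in> {..<m} \<rightarrow>\<^sub>E UNIV.
            \<bar>T (\<lambda>k\<in>{..<m}. c0_basis (j k))\<bar> powr (2 * real m / (real m + 1)))
          powr ((real m + 1) / (2 * real m))
        \<le> B * form_norm m T}"

end

theory Submission
  imports Defs
begin

text \<open>
  The exponent \<open>p = 2 m / (m + 1)\<close> is at most \<open>2\<close>, so the \<open>p\<close>-norm of a family with at most \<open>N\<close>
  nonzero entries exceeds its \<open>2\<close>-norm by at most the factor \<open>N powr (1 / p - 1 / 2)\<close>, and
  \<open>1 / p - 1 / 2 = 1 / (2 m)\<close>. The \<open>2\<close>-norm of the coefficients of a form is in turn at most the
  norm of the form: on vectors whose coordinates are independent random signs the monomials
  are orthonormal, so the mean of \<open>T\<^sup>2\<close> over such vectors is the sum of the squared coefficients.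
  Hence \<open>N powr (1 / (2 m))\<close> is an admissible constant for at most \<open>N\<close> monomials
  (\<open>admissible_constant_few_monomials\<close>), and for \<open>N = 4 ^ (m - 1)\<close> this is \<open>2 powr (1 - 1 / m)\<close>.

  Equality in both estimates asks for a form with exactly \<open>4 ^ (m - 1)\<close> coefficients, all of
  the same absolute value, say \<open>1\<close>, and with norm \<open>2 ^ (m - 1)\<close>, the \<open>2\<close>-norm of its coefficients. Such forms
  arise by iterating Littlewood's bilinear form \<open>x\<^sub>0 y\<^sub>0 + x\<^sub>0 y\<^sub>1 + x\<^sub>1 y\<^sub>0 - x\<^sub>1 y\<^sub>1\<close>: if \<open>A\<close> and \<open>B\<close>
  are two of them in \<open>m\<close> variables without a common monomial, then
  \<open>(z\<^sub>0 + z\<^sub>1) A + (z\<^sub>0 - z\<^sub>1) B\<close> has four times as many monomials, while its norm only doubles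
  because \<open>\<bar>z\<^sub>0 + z\<^sub>1\<bar> + \<bar>z\<^sub>0 - z\<^sub>1\<bar> \<le> 2\<close> (\<open>extremal_signs_exist\<close>).
\<close>

section \<open>Comparison of power sums\<close>

text \<open>
  Jensen's inequality for the convex function \<open>y powr (2 / p)\<close> and the uniform weights on \<open>S\<close>,
  applied on the open half-line to \<open>y = \<bar>a i\<bar> powr p\<close>; in the application \<open>S\<close> is the support
  of the coefficients.
\<close>

lemma lp_norm_le_card_l2_norm:
  fixes a :: "'i \<Rightarrow> real"
  assumes "finite S" and p: "0 < p" "p \<le> 2" and nz: "\<And>i. i \<in> S \<Longrightarrow> a i \<noteq> 0"
  shows "(\<Sum>i\<in>S. \<bar>a i\<bar> powr p) powr (1 / p)
           \<le> real (card S) powr (1 / p - 1 / 2) * sqrt (\<Sum>i\<in>S. (a i)\<^sup>2)"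
proof (cases "S = {}")
  case False
  define n where "n = real (card S)"
  define P where "P = (\<Sum>i\<in>S. \<bar>a i\<bar> powr p)"
  define A where "A = (\<Sum>i\<in>S. (a i)\<^sup>2)"
  have n: "n > 0" using False \<open>finite S\<close> by (simp add: n_def card_gt_0_iff)
  have P: "P > 0" unfolding P_def using nz False \<open>finite S\<close> by (intro sum_pos) auto
  have A: "A > 0" unfolding A_def using nz False \<open>finite S\<close> by (intro sum_pos) auto
  have "(\<Sum>i\<in>S. (1 / n) *\<^sub>R \<bar>a i\<bar> powr p) powr (2 / p)
          \<le> (\<Sum>i\<in>S. (1 / n) * (\<bar>a i\<bar> powr p) powr (2 / p))"
    using nz p n False \<open>finite S\<close>
    by (intro convex_on_sum[OF _ _ powr_convex]) (auto simp: n_def)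
  also have "\<dots> = A / n"
  proof -
    have "(\<bar>a i\<bar> powr p) powr (2 / p) = (a i)\<^sup>2" if "i \<in> S" for i
      using nz[OF that] p by (simp add: powr_powr)
    then show ?thesis by (simp add: A_def sum_divide_distrib)
  qed
  also have "(\<Sum>i\<in>S. (1 / n) *\<^sub>R \<bar>a i\<bar> powr p) = P / n"
    by (simp add: P_def sum_divide_distrib)
  finally have "((P / n) powr (2 / p)) powr (1 / 2) \<le> (A / n) powr (1 / 2)"
    by (intro powr_mono2) auto
  then have "(P / n) powr (1 / p) \<le> (A / n) powr (1 / 2)"
    by (simp add: powr_powr)
  then have "P powr (1 / p) \<le> n powr (1 / p) * (A / n) powr (1 / 2)"
    using P n by (simp add: powr_divide field_simps)
  also have "\<dots> = n powr (1 / p - 1 / 2) * sqrt A"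
    using A n by (simp add: powr_divide powr_diff powr_half_sqrt)
  finally show ?thesis by (simp add: P_def A_def n_def)
qed simp

section \<open>Parseval's identity for random signs\<close>

text \<open>
  A subset \<open>X\<close> of \<open>V\<close> encodes a choice of signs, with \<open>-1\<close> exactly at the points of \<open>X\<close>. Then
  \<open>walsh X A\<close> is the product of the signs over \<open>A\<close>, and averages over the random signs become
  sums over \<open>Pow V\<close>.
\<close>

definition walsh :: "'a set \<Rightarrow> 'a set \<Rightarrow> real" where
  "walsh X A = (\<Prod>a\<in>A. if a \<in> X then -1 else 1)"

lemma walsh_square: "finite A \<Longrightarrow> walsh X A * walsh X A = 1"
  unfolding walsh_def prod.distrib[symmetric] by (intro prod.neutral) auto

lemma walsh_flip:
  assumes "finite A"
  shows "walsh (sym_diff X {v}) A = (if v \<in> A then - walsh X A else walsh X A)"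
proof -
  have other: "(\<Prod>a\<in>B. if a \<in> sym_diff X {v} then -1 else 1 :: real)
                 = (\<Prod>a\<in>B. if a \<in> X then -1 else 1)" if "v \<notin> B" for B
    using that by (intro prod.cong) auto
  show ?thesis
  proof (cases "v \<in> A")
    case True
    then show ?thesis
      unfolding walsh_def using assms other[of "A - {v}"]
      by (simp add: prod.remove[OF assms True])
  next
    case False
    then show ?thesis using other[of A] by (simp add: walsh_def)
  qed
qed

text \<open>
  Flipping the sign at a point that lies in exactly one of \<open>A\<close> and \<open>B\<close> is an involution of
  \<open>Pow V\<close> that negates every summand, so the sum equals its own negative.
\<close>

lemma walsh_orthogonal:
  assumes "A \<subseteq> V" "B \<subseteq> V" "finite V" "A \<noteq> B"
  shows "(\<Sum>X\<in>Pow V. walsh X A * walsh X B) = 0"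
proof -
  obtain v where v: "v \<in> V" "v \<in> A \<longleftrightarrow> v \<notin> B" using assms by blast
  have fin: "finite A" "finite B" using assms finite_subset by blast+
  have "(\<Sum>X\<in>Pow V. walsh X A * walsh X B) = (\<Sum>X\<in>Pow V. - (walsh X A * walsh X B))"
    using v by (intro sum.reindex_bij_witness[where i = "\<lambda>X. sym_diff X {v}"
          and j = "\<lambda>X. sym_diff X {v}"]) (auto simp: walsh_flip fin)
  then show ?thesis by (simp add: sum_negf)
qed

lemma walsh_parseval:
  assumes "finite V" "finite S" "inj_on A S" "\<And>i. i \<in> S \<Longrightarrow> A i \<subseteq> V"
  shows "(\<Sum>X\<in>Pow V. (\<Sum>i\<in>S. c i * walsh X (A i))\<^sup>2) = 2 ^ card V * (\<Sum>i\<in>S. (c i)\<^sup>2)"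
proof -
  have orth: "(\<Sum>X\<in>Pow V. walsh X (A i) * walsh X (A k)) = (if k = i then 2 ^ card V else 0)"
    if "i \<in> S" "k \<in> S" for i k
  proof (cases "k = i")
    case True
    then show ?thesis
      using assms(1) finite_subset[OF assms(4)[OF that(1)] assms(1)]
      by (simp add: walsh_square card_Pow)
  next
    case False
    then have "A i \<noteq> A k" using assms(3) that by (auto simp: inj_on_def)
    then show ?thesis using walsh_orthogonal[OF assms(4,4,1)] that False by auto
  qed
  have "(\<Sum>X\<in>Pow V. (\<Sum>i\<in>S. c i * walsh X (A i))\<^sup>2)
      = (\<Sum>X\<in>Pow V. \<Sum>i\<in>S. \<Sum>k\<in>S. c i * c k * (walsh X (A i) * walsh X (A k)))"
    by (simp add: power2_eq_square sum_product mult_ac)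
  also have "\<dots> = (\<Sum>i\<in>S. \<Sum>k\<in>S. \<Sum>X\<in>Pow V. c i * c k * (walsh X (A i) * walsh X (A k)))"
    by (subst sum.swap, intro sum.cong refl, rule sum.swap)
  also have "\<dots> = (\<Sum>i\<in>S. \<Sum>k\<in>S. c i * c k * (if k = i then 2 ^ card V else 0))"
    by (intro sum.cong refl) (simp add: orth flip: sum_distrib_left)
  also have "\<dots> = (\<Sum>i\<in>S. \<Sum>k\<in>S. if k = i then c i * c k * 2 ^ card V else 0)"
    by (intro sum.cong refl) simp
  also have "\<dots> = 2 ^ card V * (\<Sum>i\<in>S. (c i)\<^sup>2)"
    using assms(2) by (simp add: power2_eq_square sum_distrib_left mult_ac)
  finally show ?thesis .
qed

text \<open>
  A monomial evaluated at signs \<open>s k n\<close> is the Walsh function of the graph of its multi-index,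
  and distinct multi-indices have distinct graphs. By Parseval's identity the sum of the
  squared coefficients is an average of squares, each at most \<open>K\<^sup>2\<close>.
\<close>

lemma l2_norm_le_of_sign_bound:
  fixes \<alpha> :: "(nat \<Rightarrow> nat) \<Rightarrow> real"
  assumes "finite S" and S: "S \<subseteq> {..<m} \<rightarrow>\<^sub>E {..<N::nat}"
    and bound: "\<And>s. (\<And>k n. \<bar>s k n\<bar> = 1) \<Longrightarrow> \<bar>\<Sum>j\<in>S. \<alpha> j * (\<Prod>k<m. s k (j k))\<bar> \<le> K"
  shows "sqrt (\<Sum>j\<in>S. (\<alpha> j)\<^sup>2) \<le> K"
proof -
  define V where "V = {..<m} \<times> {..<N}"
  define G :: "(nat \<Rightarrow> nat) \<Rightarrow> (nat \<times> nat) set"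
    where "G = (\<lambda>j. (\<lambda>k. (k, j k)) ` {..<m})"
  have "K \<ge> 0" using bound[of "\<lambda>_ _. 1"] by simp
  have inj: "inj_on G S"
  proof (rule inj_onI)
    fix i j assume "i \<in> S" "j \<in> S" "G i = G j"
    show "i = j"
    proof (rule PiE_ext)
      show "i \<in> {..<m} \<rightarrow>\<^sub>E {..<N}" "j \<in> {..<m} \<rightarrow>\<^sub>E {..<N}"
        using S \<open>i \<in> S\<close> \<open>j \<in> S\<close> by auto
      show "i k = j k" if "k \<in> {..<m}" for k
      proof -
        have "(k, i k) \<in> G j" using that \<open>G i = G j\<close> by (auto simp: G_def)
        then show ?thesis by (auto simp: G_def)
      qed
    qed
  qed
  have walsh: "walsh X (G j) = (\<Prod>k<m. if (k, j k) \<in> X then -1 else 1)" for X j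
    unfolding walsh_def G_def by (subst prod.reindex) (auto simp: inj_on_def)
  have "2 ^ card V * (\<Sum>j\<in>S. (\<alpha> j)\<^sup>2) = (\<Sum>X\<in>Pow V. (\<Sum>j\<in>S. \<alpha> j * walsh X (G j))\<^sup>2)"
    using inj \<open>finite S\<close> S
    by (intro walsh_parseval[symmetric]) (auto simp: V_def G_def PiE_iff subset_iff)
  also have "\<dots> \<le> (\<Sum>X\<in>Pow V. K\<^sup>2)"
  proof (rule sum_mono)
    fix X
    have "\<bar>\<Sum>j\<in>S. \<alpha> j * walsh X (G j)\<bar> \<le> K"
      unfolding walsh by (rule bound) simp
    then show "(\<Sum>j\<in>S. \<alpha> j * walsh X (G j))\<^sup>2 \<le> K\<^sup>2"
      by (simp add: abs_le_square_iff[symmetric] \<open>K \<ge> 0\<close>)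
  qed
  also have "\<dots> = 2 ^ card V * K\<^sup>2"
    by (simp add: V_def card_Pow)
  finally show ?thesis
    using \<open>K \<ge> 0\<close> by (intro real_le_lsqrt) (auto simp: sum_nonneg)
qed

section \<open>Forms with finitely many monomials\<close>

definition finite_form :: "nat \<Rightarrow> (nat \<Rightarrow> nat) set \<Rightarrow> ((nat \<Rightarrow> nat) \<Rightarrow> real) \<Rightarrow> (nat \<Rightarrow> c0) \<Rightarrow> real"
  where "finite_form m S \<alpha> x = (\<Sum>j\<in>S. \<alpha> j * (\<Prod>k<m. c0_coord (x k) (j k)))"

lemma finite_subset_cube:
  fixes S :: "(nat \<Rightarrow> nat) set"
  assumes "finite S" "S \<subseteq> {..<m} \<rightarrow>\<^sub>E UNIV"
  obtains M where "S \<subseteq> {..<m} \<rightarrow>\<^sub>E {..<M}"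
proof -
  have "finite (\<Union>j\<in>S. j ` {..<m})" using assms(1) by simp
  then obtain M where "\<forall>n \<in> (\<Union>j\<in>S. j ` {..<m}). n < M"
    using finite_nat_set_iff_bounded by blast
  then have "j \<in> {..<m} \<rightarrow>\<^sub>E {..<M}" if "j \<in> S" for j
    using assms(2) that by (auto simp: PiE_iff subset_iff)
  then show ?thesis by (intro that subsetI)
qed

lemma cubical_sums_tendsto_finite_form:
  assumes "finite S" "S \<subseteq> {..<m} \<rightarrow>\<^sub>E UNIV" "\<And>j. j \<in> ({..<m} \<rightarrow>\<^sub>E UNIV) - S \<Longrightarrow> \<alpha> j = 0"
  shows "(\<lambda>N. \<Sum>j \<in> {..<m} \<rightarrow>\<^sub>E {..<N}. \<alpha> j * (\<Prod>k<m. c0_coord (x k) (j k)))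
           \<longlonglongrightarrow> finite_form m S \<alpha> x"
proof -
  obtain M where M: "S \<subseteq> {..<m} \<rightarrow>\<^sub>E {..<M}"
    using finite_subset_cube[OF assms(1,2)] .
  have "(\<Sum>j \<in> {..<m} \<rightarrow>\<^sub>E {..<N}. \<alpha> j * (\<Prod>k<m. c0_coord (x k) (j k))) = finite_form m S \<alpha> x"
    if "N \<ge> M" for N
    unfolding finite_form_def
  proof (rule sum.mono_neutral_right)
    show "finite ({..<m} \<rightarrow>\<^sub>E {..<N})" by (intro finite_PiE) auto
    show "S \<subseteq> {..<m} \<rightarrow>\<^sub>E {..<N}"
      using M that by (meson PiE_mono lessThan_subset_iff order_trans)
    show "\<forall>j\<in>({..<m} \<rightarrow>\<^sub>E {..<N}) - S. \<alpha> j * (\<Prod>k<m. c0_coord (x k) (j k)) = 0"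
      using assms(3) by (auto simp: PiE_iff)
  qed
  then show ?thesis by (intro tendsto_eventually eventually_sequentiallyI)
qed

lemma monomial_expansion_eq_finite_form:
  assumes "monomial_expansion m T \<alpha>" "finite {j \<in> {..<m} \<rightarrow>\<^sub>E UNIV. \<alpha> j \<noteq> 0}"
    and x: "x \<in> {..<m} \<rightarrow>\<^sub>E UNIV"
  shows "T x = finite_form m {j \<in> {..<m} \<rightarrow>\<^sub>E UNIV. \<alpha> j \<noteq> 0} \<alpha> x"
proof (rule LIMSEQ_unique)
  show "(\<lambda>N. \<Sum>j \<in> {..<m} \<rightarrow>\<^sub>E {..<N}. \<alpha> j * (\<Prod>k<m. c0_coord (x k) (j k))) \<longlonglongrightarrow> T x"
    using assms(1) x unfolding monomial_expansion_def by blast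
  show "(\<lambda>N. \<Sum>j \<in> {..<m} \<rightarrow>\<^sub>E {..<N}. \<alpha> j * (\<Prod>k<m. c0_coord (x k) (j k)))
      \<longlonglongrightarrow> finite_form m {j \<in> {..<m} \<rightarrow>\<^sub>E UNIV. \<alpha> j \<noteq> 0} \<alpha> x"
    by (rule cubical_sums_tendsto_finite_form[OF assms(2)]) simp_all
qed

lemma abs_finite_form_le:
  assumes "\<And>k. k < m \<Longrightarrow> norm (x k) \<le> 1"
  shows "\<bar>finite_form m S \<alpha> x\<bar> \<le> (\<Sum>j\<in>S. \<bar>\<alpha> j\<bar>)"
proof -
  have "\<bar>finite_form m S \<alpha> x\<bar> \<le> (\<Sum>j\<in>S. \<bar>\<alpha> j * (\<Prod>k<m. c0_coord (x k) (j k))\<bar>)"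
    unfolding finite_form_def by (rule sum_abs)
  also have "\<dots> \<le> (\<Sum>j\<in>S. \<bar>\<alpha> j\<bar>)"
  proof (rule sum_mono)
    fix j
    have "\<bar>\<Prod>k<m. c0_coord (x k) (j k)\<bar> \<le> 1"
      unfolding abs_prod using assms abs_c0_coord_le_norm
      by (intro prod_le_1) (auto intro: order_trans)
    then show "\<bar>\<alpha> j * (\<Prod>k<m. c0_coord (x k) (j k))\<bar> \<le> \<bar>\<alpha> j\<bar>"
      by (simp add: abs_mult mult_left_le)
  qed
  finally show ?thesis .
qed

lemma linear_c0_coord: "linear (\<lambda>u. c0_coord u n)"
  by (intro linearI) auto

lemma continuous_c0_coord: "continuous_on UNIV (\<lambda>u. c0_coord u n)"
  by (intro linear_continuous_on bounded_linear_intro[where K = 1])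
    (auto simp: abs_c0_coord_le_norm)

lemma multilinear_finite_form: "multilinear_form m (finite_form m S \<alpha>)"
  unfolding multilinear_form_def
proof (intro ballI allI impI)
  fix x :: "nat \<Rightarrow> c0" and k assume "k < m"
  have "(\<Prod>i<m. c0_coord ((x(k := u)) i) (j i))
          = c0_coord u (j k) * (\<Prod>i\<in>{..<m} - {k}. c0_coord (x i) (j i))" for u j
    using \<open>k < m\<close> by (subst prod.remove[of _ k]) auto
  then have "(\<lambda>u. finite_form m S \<alpha> (x(k := u)))
      = (\<lambda>u. \<Sum>j\<in>S. (\<alpha> j * (\<Prod>i\<in>{..<m} - {k}. c0_coord (x i) (j i))) *\<^sub>R c0_coord u (j k))"
    by (simp add: finite_form_def mult_ac)
  then show "linear (\<lambda>u. finite_form m S \<alpha> (x(k := u)))"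
    by (simp only:) (intro linear_compose_sum ballI linear_compose_scale_right linear_c0_coord)
qed

lemma continuous_multilinear_finite_form:
  assumes "finite S"
  shows "continuous_multilinear_form m (finite_form m S \<alpha>)"
proof -
  have coord: "continuous_map (product_topology (\<lambda>_. euclidean) {..<m}) euclideanreal
      (\<lambda>x :: nat \<Rightarrow> c0. c0_coord (x k) n)" if "k < m" for k n
    using continuous_map_compose[OF continuous_map_product_projection[of k "{..<m}" "\<lambda>_. euclidean"],
        of euclideanreal "\<lambda>u. c0_coord u n"] continuous_c0_coord that
    by (simp add: o_def)
  have "continuous_map (product_topology (\<lambda>_. euclidean) {..<m}) euclideanreal
      (\<lambda>x. \<Sum>j\<in>S. \<alpha> j * (\<Prod>k<m. c0_coord (x k) (j k)))"
    using assms
    by (intro continuous_map_sum continuous_map_real_mult_left continuous_map_prod coord) auto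
  then show ?thesis
    using multilinear_finite_form[of m S \<alpha>]
    by (simp add: continuous_multilinear_form_def finite_form_def[abs_def])
qed

lemma finite_form_extended_coefficients:
  "finite_form m S (\<lambda>j. if j \<in> S then \<alpha> j else 0) = finite_form m S \<alpha>"
  by (simp add: finite_form_def fun_eq_iff)

lemma monomial_expansion_finite_form:
  assumes "finite S" "S \<subseteq> {..<m} \<rightarrow>\<^sub>E UNIV"
  shows "monomial_expansion m (finite_form m S \<alpha>) (\<lambda>j. if j \<in> S then \<alpha> j else 0)"
  using cubical_sums_tendsto_finite_form[OF assms, of "\<lambda>j. if j \<in> S then \<alpha> j else 0"]
  by (simp add: monomial_expansion_def finite_form_extended_coefficients)

lemma at_most_monomials_finite_form:
  assumes "finite S" "S \<subseteq> {..<m} \<rightarrow>\<^sub>E UNIV" "card S \<le> N"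
  shows "at_most_monomials m (finite_form m S \<alpha>) N"
proof -
  let ?\<beta> = "\<lambda>j. if j \<in> S then \<alpha> j else 0"
  have sub: "{j \<in> {..<m} \<rightarrow>\<^sub>E UNIV. ?\<beta> j \<noteq> 0} \<subseteq> S" by (auto split: if_splits)
  show ?thesis
    unfolding at_most_monomials_def
  proof (intro exI[of _ ?\<beta>] conjI)
    show "monomial_expansion m (finite_form m S \<alpha>) ?\<beta>"
      by (rule monomial_expansion_finite_form[OF assms(1,2)])
    show "finite {j \<in> {..<m} \<rightarrow>\<^sub>E UNIV. ?\<beta> j \<noteq> 0}"
      by (rule finite_subset[OF sub assms(1)])
    show "card {j \<in> {..<m} \<rightarrow>\<^sub>E UNIV. ?\<beta> j \<noteq> 0} \<le> N"
      by (rule order_trans[OF card_mono[OF assms(1) sub] assms(3)])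
  qed
qed

lemma infsum_coefficients:
  fixes p :: real
  assumes "monomial_expansion m T \<alpha>" "finite S" "S \<subseteq> {..<m} \<rightarrow>\<^sub>E UNIV"
    "\<And>j. j \<in> ({..<m} \<rightarrow>\<^sub>E UNIV) - S \<Longrightarrow> \<alpha> j = 0"
  shows "(\<Sum>\<^sub>\<infinity>j \<in> {..<m} \<rightarrow>\<^sub>E UNIV. \<bar>T (\<lambda>k\<in>{..<m}. c0_basis (j k))\<bar> powr p)
           = (\<Sum>j\<in>S. \<bar>\<alpha> j\<bar> powr p)"
proof -
  have "(\<Sum>\<^sub>\<infinity>j \<in> {..<m} \<rightarrow>\<^sub>E UNIV. \<bar>T (\<lambda>k\<in>{..<m}. c0_basis (j k))\<bar> powr p)
      = (\<Sum>\<^sub>\<infinity>j\<in>S. \<bar>\<alpha> j\<bar> powr p)"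
    using assms(3,4) monomial_expansion_coefficient[OF assms(1)]
    by (intro infsum_cong_neutral) auto
  then show ?thesis using assms(2) by simp
qed

section \<open>The upper bound\<close>

text \<open>
  A sequence of signs is not a null sequence. The finitely many monomials only see
  coordinates below some bound \<open>N\<close>, so cutting the sequence off at \<open>N\<close> changes no value.
\<close>

lift_definition c0_truncation :: "nat \<Rightarrow> (nat \<Rightarrow> real) \<Rightarrow> c0" is "\<lambda>N s n. if n < N then s n else 0"
proof -
  fix N :: nat and s :: "nat \<Rightarrow> real"
  show "(\<lambda>n. if n < N then s n else 0) \<longlonglongrightarrow> 0"
    by (intro tendsto_eventually eventually_sequentiallyI[of N]) auto
qed

text \<open>
  The supremum in \<^const>\<open>form_norm\<close> dominates the values of \<open>T\<close> only if these are bounded on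
  the product of the balls; the bound \<open>C\<close> guarantees this.
\<close>

lemma abs_le_form_norm:
  assumes "\<And>x. x \<in> {..<m} \<rightarrow>\<^sub>E cball 0 1 \<Longrightarrow> \<bar>T x\<bar> \<le> C" "x \<in> {..<m} \<rightarrow>\<^sub>E cball 0 1"
  shows "\<bar>T x\<bar> \<le> form_norm m T"
  unfolding form_norm_def using assms by (intro cSUP_upper bdd_aboveI2[where M = C]) auto

lemma l2_coefficients_le_form_norm:
  assumes "monomial_expansion m T \<alpha>"
    and S_def: "S = {j \<in> {..<m} \<rightarrow>\<^sub>E UNIV. \<alpha> j \<noteq> 0}" and "finite S"
  shows "sqrt (\<Sum>j\<in>S. (\<alpha> j)\<^sup>2) \<le> form_norm m T"
proof -
  have T: "T x = finite_form m S \<alpha> x" if "x \<in> {..<m} \<rightarrow>\<^sub>E A" for x A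
    using monomial_expansion_eq_finite_form[of m T \<alpha> x] assms that by (auto simp: PiE_iff)
  have "S \<subseteq> {..<m} \<rightarrow>\<^sub>E UNIV" by (auto simp: S_def)
  then obtain N where N: "S \<subseteq> {..<m} \<rightarrow>\<^sub>E {..<N}"
    using finite_subset_cube \<open>finite S\<close> by blast
  show ?thesis
  proof (rule l2_norm_le_of_sign_bound[OF \<open>finite S\<close> N])
    fix s :: "nat \<Rightarrow> nat \<Rightarrow> real"
    assume s: "\<And>k n. \<bar>s k n\<bar> = 1"
    let ?x = "\<lambda>k\<in>{..<m}. c0_truncation N (s k)"
    have x: "?x \<in> {..<m} \<rightarrow>\<^sub>E cball 0 1"
      by (auto intro!: norm_c0_le simp: c0_truncation.rep_eq s)
    have "finite_form m S \<alpha> ?x = (\<Sum>j\<in>S. \<alpha> j * (\<Prod>k<m. s k (j k)))"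
      unfolding finite_form_def
    proof (intro sum.cong refl arg_cong2[where f = "(*)"] prod.cong)
      fix j k assume "j \<in> S" "k \<in> {..<m}"
      then have "j k < N" using N by (auto simp: PiE_iff subset_iff)
      then show "c0_coord (?x k) (j k) = s k (j k)"
        using \<open>k \<in> {..<m}\<close> by (simp add: c0_truncation.rep_eq)
    qed
    moreover have "\<bar>T ?x\<bar> \<le> form_norm m T"
    proof (rule abs_le_form_norm[OF _ x])
      fix x :: "nat \<Rightarrow> c0" assume x: "x \<in> {..<m} \<rightarrow>\<^sub>E cball 0 1"
      show "\<bar>T x\<bar> \<le> (\<Sum>j\<in>S. \<bar>\<alpha> j\<bar>)"
        unfolding T[OF x] using x by (intro abs_finite_form_le) (auto simp: PiE_iff)
    qed
    ultimately show "\<bar>\<Sum>j\<in>S. \<alpha> j * (\<Prod>k<m. s k (j k))\<bar> \<le> form_norm m T"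
      using T[OF x] by simp
  qed
qed

lemma admissible_constant_few_monomials:
  assumes "m \<ge> 1"
  shows "real N powr (1 / (2 * real m)) \<in> admissible_constants m N"
  unfolding admissible_constants_def
proof (intro CollectI allI impI)
  fix T assume "at_most_monomials m T N"
  then obtain \<alpha> where \<alpha>: "monomial_expansion m T \<alpha>"
    and "finite {j \<in> {..<m} \<rightarrow>\<^sub>E UNIV. \<alpha> j \<noteq> 0}" "card {j \<in> {..<m} \<rightarrow>\<^sub>E UNIV. \<alpha> j \<noteq> 0} \<le> N"
    unfolding at_most_monomials_def by blast
  define S where "S = {j \<in> {..<m} \<rightarrow>\<^sub>E UNIV. \<alpha> j \<noteq> 0}"
  have S: "finite S" "card S \<le> N" by (simp_all add: S_def) fact+
  define p where "p = 2 * real m / (real m + 1)"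
  have p: "0 < p" "p \<le> 2" "1 / p - 1 / 2 = 1 / (2 * real m)" "1 / p = (real m + 1) / (2 * real m)"
    using \<open>m \<ge> 1\<close> by (auto simp: p_def field_simps)
  have "(\<Sum>\<^sub>\<infinity>j \<in> {..<m} \<rightarrow>\<^sub>E UNIV. \<bar>T (\<lambda>k\<in>{..<m}. c0_basis (j k))\<bar> powr p)
          = (\<Sum>j\<in>S. \<bar>\<alpha> j\<bar> powr p)"
    by (rule infsum_coefficients[OF \<alpha> S(1)]) (auto simp only: S_def)
  moreover have "(\<Sum>j\<in>S. \<bar>\<alpha> j\<bar> powr p) powr (1 / p)
          \<le> real (card S) powr (1 / (2 * real m)) * sqrt (\<Sum>j\<in>S. (\<alpha> j)\<^sup>2)"
    using lp_norm_le_card_l2_norm[OF S(1) p(1,2), of \<alpha>] p(3) by (simp add: S_def)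
  moreover have "real (card S) powr (1 / (2 * real m)) * sqrt (\<Sum>j\<in>S. (\<alpha> j)\<^sup>2)
          \<le> real N powr (1 / (2 * real m)) * form_norm m T"
    using S l2_coefficients_le_form_norm[OF \<alpha> S_def S(1)]
    by (intro mult_mono powr_mono2) (auto simp: sum_nonneg)
  ultimately show "(\<Sum>\<^sub>\<infinity>j \<in> {..<m} \<rightarrow>\<^sub>E UNIV.
            \<bar>T (\<lambda>k\<in>{..<m}. c0_basis (j k))\<bar> powr (2 * real m / (real m + 1)))
          powr ((real m + 1) / (2 * real m)) \<le> real N powr (1 / (2 * real m)) * form_norm m T"
    unfolding p_def[symmetric] p(4)[symmetric] by (simp only:)
qed

section \<open>Extremal forms\<close>

lemma abs_sum_diff_le:
  fixes a b c d A :: real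
  assumes "\<bar>a\<bar> \<le> A" "\<bar>b\<bar> \<le> A" "\<bar>c\<bar> \<le> 1" "\<bar>d\<bar> \<le> 1"
  shows "\<bar>(c + d) * a + (c - d) * b\<bar> \<le> 2 * A"
proof -
  have "\<bar>(c + d) * a + (c - d) * b\<bar> \<le> \<bar>c + d\<bar> * \<bar>a\<bar> + \<bar>c - d\<bar> * \<bar>b\<bar>"
    by (metis abs_mult abs_triangle_ineq)
  also have "\<dots> \<le> \<bar>c + d\<bar> * A + \<bar>c - d\<bar> * A"
    using assms by (intro add_mono mult_left_mono) auto
  also have "\<dots> = (\<bar>c + d\<bar> + \<bar>c - d\<bar>) * A" by (simp add: algebra_simps)
  also have "\<dots> \<le> 2 * A" using assms by (intro mult_right_mono) auto
  finally show ?thesis .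
qed

text \<open>
  The monomials and signs of an extremal form in \<open>n + 1\<close> variables. The parameter \<open>s\<close> confines
  the last index to \<open>2 s\<close> and \<open>2 s + 1\<close>, so that forms for different \<open>s\<close> have no monomial in
  common; this is what lets the construction be iterated. The bound is required at all arrays
  of numbers of absolute value at most \<open>1\<close>, which includes the points of the unit balls.
\<close>

definition extremal_signs ::
    "nat \<Rightarrow> nat \<Rightarrow> (nat \<Rightarrow> nat) set \<Rightarrow> ((nat \<Rightarrow> nat) \<Rightarrow> real) \<Rightarrow> bool" where
  "extremal_signs n s S \<epsilon> \<longleftrightarrow>
     S \<subseteq> {..<Suc n} \<rightarrow>\<^sub>E UNIV \<and> finite S \<and> card S = 4 ^ n \<and>
     (\<forall>j\<in>S. j n div 2 = s) \<and> (\<forall>j. \<bar>\<epsilon> j\<bar> = 1) \<and>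
     (\<forall>x. (\<forall>k i. \<bar>x k i\<bar> \<le> 1) \<longrightarrow> \<bar>\<Sum>j\<in>S. \<epsilon> j * (\<Prod>k<Suc n. x k (j k))\<bar> \<le> 2 ^ n)"

lemma extremal_signsD:
  assumes "extremal_signs n s S \<epsilon>"
  shows "S \<subseteq> {..<Suc n} \<rightarrow>\<^sub>E UNIV" "finite S" "card S = 4 ^ n"
    "\<And>j. j \<in> S \<Longrightarrow> j n div 2 = s" "\<And>j. \<bar>\<epsilon> j\<bar> = 1"
    "\<And>x. (\<And>k i. \<bar>x k i\<bar> \<le> 1) \<Longrightarrow> \<bar>\<Sum>j\<in>S. \<epsilon> j * (\<Prod>k<Suc n. x k (j k))\<bar> \<le> 2 ^ n"
  using assms unfolding extremal_signs_def by blast+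

lemma extremal_signs_exist: "\<exists>S \<epsilon>. extremal_signs n s S \<epsilon>"
proof (induction n arbitrary: s)
  case 0
  have "extremal_signs 0 s {\<lambda>k\<in>{..<Suc 0}. 2 * s} (\<lambda>_. 1)"
    by (simp add: extremal_signs_def)
  then show ?case by blast
next
  case (Suc n)
  obtain S \<epsilon> where "extremal_signs n 0 S \<epsilon>" using Suc by blast
  note S = extremal_signsD[OF this]
  obtain S' \<epsilon>' where "extremal_signs n 1 S' \<epsilon>'" using Suc by blast
  note S' = extremal_signsD[OF this]
  \<comment> \<open>With \<open>z\<close> the new variable, the form is
      \<open>(z\<^sub>2\<^sub>s + z\<^sub>2\<^sub>s\<^sub>+\<^sub>1) A + (z\<^sub>2\<^sub>s - z\<^sub>2\<^sub>s\<^sub>+\<^sub>1) B\<close> for the forms \<open>A\<close> on \<open>S\<close> and \<open>B\<close> on \<open>S'\<close>.\<close>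
  have disj: "S \<inter> S' = {}" using S(4) S'(4) by fastforce
  define h :: "nat \<times> (nat \<Rightarrow> nat) \<Rightarrow> nat \<Rightarrow> nat" where "h = (\<lambda>(c, j). j(Suc n := c))"
  define U where "U = {2 * s, 2 * s + 1} \<times> (S \<union> S')"
  define R where "R = h ` U"
  \<comment> \<open>The index in position \<open>n\<close> tells whether a multi-index extends one of \<open>S\<close> or one of \<open>S'\<close>.\<close>
  define \<delta> where "\<delta> = (\<lambda>j. if j n div 2 = 0 then \<epsilon> (restrict j {..<Suc n})
      else (if j (Suc n) = 2 * s then 1 else -1) * \<epsilon>' (restrict j {..<Suc n}))"
  have ext: "j \<in> {..<Suc n} \<rightarrow>\<^sub>E UNIV" if "j \<in> S \<union> S'" for j using that S(1) S'(1) by auto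
  have restr: "restrict (h (c, j)) {..<Suc n} = j" if "j \<in> S \<union> S'" for c j
    using ext[OF that] by (auto simp: h_def PiE_iff extensional_def restrict_def fun_eq_iff)
  have inj: "inj_on h U"
  proof (rule inj_onI)
    fix a b assume "a \<in> U" "b \<in> U" and eq: "h a = h b"
    obtain c j d i where ab: "a = (c, j)" "b = (d, i)" by fastforce
    then have "j \<in> S \<union> S'" "i \<in> S \<union> S'"
      using \<open>a \<in> U\<close> \<open>b \<in> U\<close> unfolding U_def by blast+
    then have "j = i" using restr[of j c] restr[of i d] eq ab by argo
    moreover have "c = d" using fun_cong[OF eq, of "Suc n"] by (simp add: h_def ab)
    ultimately show "a = b" by (simp add: ab)
  qed
  have "extremal_signs (Suc n) s R \<delta>"
    unfolding extremal_signs_def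
  proof (intro conjI ballI allI impI)
    show "R \<subseteq> {..<Suc (Suc n)} \<rightarrow>\<^sub>E UNIV"
    proof
      fix i assume "i \<in> R"
      then obtain c j where "i = j(Suc n := c)" "j \<in> S \<union> S'"
        by (auto simp: R_def U_def h_def)
      then show "i \<in> {..<Suc (Suc n)} \<rightarrow>\<^sub>E UNIV"
        using ext[of j] by (simp add: PiE_iff extensional_def)
    qed
    show "finite R" using S(2) S'(2) by (simp add: R_def U_def)
    have "card R = card U" unfolding R_def by (rule card_image[OF inj])
    also have "\<dots> = 2 * (card S + card S')"
      using S(2) S'(2) disj by (simp add: U_def card_cartesian_product card_Un_disjoint)
    finally show "card R = 4 ^ Suc n" using S(3) S'(3) by simp
    show "j (Suc n) div 2 = s" if "j \<in> R" for j
      using that by (auto simp: R_def U_def h_def)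
    show "\<bar>\<delta> j\<bar> = 1" for j using S(5) S'(5) by (simp add: \<delta>_def abs_mult)
    fix x :: "nat \<Rightarrow> nat \<Rightarrow> real" assume x: "\<forall>k i. \<bar>x k i\<bar> \<le> 1"
    define P where "P = (\<lambda>j. \<Prod>k<Suc n. x k (j k))"
    have P: "(\<Prod>k<Suc (Suc n). x k (h (c, j) k)) = x (Suc n) c * P j" for c j
      by (simp add: P_def h_def mult_ac)
    have d0: "\<delta> (h (c, j)) = \<epsilon> j" if "j \<in> S" for c j
      using that S(4)[OF that] restr[of j c] by (simp add: \<delta>_def) (simp add: h_def)
    have d1: "\<delta> (h (c, j)) = (if c = 2 * s then 1 else -1) * \<epsilon>' j" if "j \<in> S'" for c j
      using that S'(4)[OF that] restr[of j c] by (simp add: \<delta>_def) (simp add: h_def)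
    let ?x0 = "x (Suc n) (2 * s)" and ?x1 = "x (Suc n) (2 * s + 1)"
    have "(\<Sum>j\<in>R. \<delta> j * (\<Prod>k<Suc (Suc n). x k (j k)))
        = (\<Sum>(c, j)\<in>U. \<delta> (h (c, j)) * (x (Suc n) c * P j))"
      unfolding R_def by (subst sum.reindex[OF inj]) (simp only: o_def case_prod_unfold P[symmetric] prod.collapse)
    also have "\<dots> = (\<Sum>c\<in>{2 * s, 2 * s + 1}. \<Sum>j\<in>S \<union> S'. \<delta> (h (c, j)) * (x (Suc n) c * P j))"
      unfolding U_def by (rule sum.cartesian_product[symmetric])
    also have "\<dots> = (\<Sum>c\<in>{2 * s, 2 * s + 1}. (\<Sum>j\<in>S. \<epsilon> j * (x (Suc n) c * P j))
        + (\<Sum>j\<in>S'. (if c = 2 * s then 1 else -1) * \<epsilon>' j * (x (Suc n) c * P j)))"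
      using S(2) S'(2) disj by (simp only: sum.union_disjoint d0 d1 cong: sum.cong)
    also have "\<dots> = (\<Sum>c\<in>{2 * s, 2 * s + 1}. x (Suc n) c * (\<Sum>j\<in>S. \<epsilon> j * P j)
        + (if c = 2 * s then 1 else -1) * x (Suc n) c * (\<Sum>j\<in>S'. \<epsilon>' j * P j))"
      by (simp only: sum_distrib_left mult.assoc mult.left_commute)
    also have "\<dots> = (?x0 + ?x1) * (\<Sum>j\<in>S. \<epsilon> j * P j) + (?x0 - ?x1) * (\<Sum>j\<in>S'. \<epsilon>' j * P j)"
      by (simp add: distrib_right left_diff_distrib)
    finally show "\<bar>\<Sum>j\<in>R. \<delta> j * (\<Prod>k<Suc (Suc n). x k (j k))\<bar> \<le> 2 ^ Suc n"
      using abs_sum_diff_le[OF S(6) S'(6), of x x ?x0 ?x1] x by (simp add: P_def)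
  qed
  then show ?case by blast
qed

text \<open>
  On an extremal form the left-hand side is \<open>4 ^ (m - 1)\<close> raised to \<open>(m + 1) / (2 m)\<close>, that is
  \<open>2 powr (1 - 1 / m) * 2 ^ (m - 1)\<close>, and the norm is at most \<open>2 ^ (m - 1)\<close>.
\<close>

lemma admissible_constant_lower_bound:
  assumes "m \<ge> 1" and B: "B \<in> admissible_constants m (4 ^ (m - 1))"
  shows "2 powr (1 - 1 / real m) \<le> B"
proof -
  define n where "n = m - 1"
  have m: "m = Suc n" using assms by (simp add: n_def)
  obtain S \<epsilon> where E: "extremal_signs n 0 S \<epsilon>" using extremal_signs_exist by blast
  note S = extremal_signsD(1-3)[OF E, folded m] and \<epsilon> = extremal_signsD(5)[OF E]
    and bound = extremal_signsD(6)[OF E, folded m]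
  define T where "T = finite_form m S \<epsilon>"
  have T_le: "\<bar>T x\<bar> \<le> 2 ^ n" if x: "x \<in> {..<m} \<rightarrow>\<^sub>E cball 0 1" for x
  proof -
    \<comment> \<open>Only the factors below \<open>m\<close> are known to lie in the unit ball; the others become \<open>0\<close>.\<close>
    have "T x = (\<Sum>j\<in>S. \<epsilon> j * (\<Prod>k<m. (if k < m then c0_coord (x k) (j k) else 0)))"
      by (simp add: T_def finite_form_def)
    moreover have "\<bar>if k < m then c0_coord (x k) i else 0\<bar> \<le> 1" for k i
      using x abs_c0_coord_le_norm[of "x k" i] by (force simp: PiE_iff)
    ultimately show ?thesis
      using bound[of "\<lambda>k i. if k < m then c0_coord (x k) i else 0"] by simp
  qed
  have zero: "(\<lambda>k\<in>{..<m}. 0 :: c0) \<in> {..<m} \<rightarrow>\<^sub>E cball 0 1" by auto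
  have norm_le: "form_norm m T \<le> 2 ^ n"
    unfolding form_norm_def using zero T_le by (intro cSUP_least) blast+
  have norm_ge: "form_norm m T \<ge> 0"
    using abs_le_form_norm[of m T, OF T_le zero] by simp
  define p where "p = 2 * real m / (real m + 1)"
  define q where "q = (real m + 1) / (2 * real m)"
  have "(\<Sum>\<^sub>\<infinity>j \<in> {..<m} \<rightarrow>\<^sub>E UNIV. \<bar>T (\<lambda>k\<in>{..<m}. c0_basis (j k))\<bar> powr p) = 4 ^ n"
    using infsum_coefficients[OF monomial_expansion_finite_form[OF S(2,1)] S(2,1), of \<epsilon> p] \<epsilon> S(3)
    by (simp add: T_def)
  moreover have "continuous_multilinear_form m T"
    unfolding T_def by (rule continuous_multilinear_finite_form[OF S(2)])
  moreover have "at_most_monomials m T (4 ^ (m - 1))"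
    unfolding T_def using S(3) by (intro at_most_monomials_finite_form[OF S(2,1)]) (simp add: n_def)
  ultimately have main: "(4 ^ n) powr q \<le> B * form_norm m T"
    using B unfolding admissible_constants_def p_def[symmetric] q_def[symmetric] by fastforce
  \<comment> \<open>The norm is only bounded from above, so replacing it by the bound needs the sign of \<open>B\<close>.\<close>
  have "B \<ge> 0"
  proof (rule ccontr)
    assume "\<not> B \<ge> 0"
    then have "B * form_norm m T \<le> 0" using norm_ge by (simp add: mult_nonpos_nonneg)
    moreover have "(4 ^ n) powr q > (0 :: real)" by simp
    ultimately show False using main by linarith
  qed
  have "2 powr (1 - 1 / real m) * 2 powr real n = 2 powr (2 * real n * q)"
  proof -
    have "1 - 1 / real m + real n = 2 * real n * q"
      by (simp add: q_def m field_simps)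
    then show ?thesis by (simp only: powr_add[symmetric])
  qed
  also have "\<dots> = (2 powr real (2 * n)) powr q" by (simp add: powr_powr)
  also have "2 powr real (2 * n) = (4 ^ n :: real)"
    by (subst powr_realpow) (simp_all add: power_mult)
  also have "(4 ^ n) powr q \<le> B * 2 ^ n"
    using main mult_left_mono[OF norm_le \<open>B \<ge> 0\<close>] by linarith
  finally show ?thesis by (simp add: powr_realpow)
qed

theorem corollary5p6:
  fixes m :: nat
  assumes "m \<ge> 1"
  shows "2 powr (1 - 1 / real m) \<in> admissible_constants m (4 ^ (m - 1)) \<and>
         (\<forall>B \<in> admissible_constants m (4 ^ (m - 1)). 2 powr (1 - 1 / real m) \<le> B)"
proof
  have "real (4 ^ (m - 1)) = 2 powr (2 * (real m - 1))"
    using assms powr_realpow[of 2 "2 * (m - 1)"] by (simp add: power_mult of_nat_diff)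
  moreover have "2 * (real m - 1) * (1 / (2 * real m)) = 1 - 1 / real m"
    using assms by (simp add: field_simps)
  ultimately have "real (4 ^ (m - 1)) powr (1 / (2 * real m)) = 2 powr (1 - 1 / real m)"
    by (simp only: powr_powr)
  then show "2 powr (1 - 1 / real m) \<in> admissible_constants m (4 ^ (m - 1))"
    using admissible_constant_few_monomials[OF assms, of "4 ^ (m - 1)"] by simp
  show "\<forall>B \<in> admissible_constants m (4 ^ (m - 1)). 2 powr (1 - 1 / real m) \<le> B"
    using admissible_constant_lower_bound[OF assms] by blast
qed

end
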